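(* Let $\alpha\neq\beta$ be complex numbers, and let $\mathcal{E}\subset\mathbb{C}P^2$ be the singular cubic given in the affine chart $\{\xi=1\}$ by $\eta^2=(\zeta-\alpha)^2(\zeta-\beta)$. Then the addition of points on $\mathcal{E}$ and the involution $\sigma:(\zeta,\eta)\mapsto(\zeta,-\eta)$, $\infty\mapsto\infty$, define a unique structure, independent of the parameters $\alpha$ and $\beta$ up to isomorphism, of a two-valued coset algebraic monoid $\mathbb{M}_{\mathrm{node}}(\mathbb{C}P^1)$ on $\mathbb{C}P^1$, with neutral element $\infty$ and operation $$\zeta_1\ast\zeta_2=\left[\left(\frac{\sqrt{\zeta_1-\beta}\sqrt{\zeta_2-\beta}\pm(\alpha-\beta)}{\sqrt{\zeta_1-\beta}\pm\sqrt{\zeta_2-\beta}}\right)^2+\beta\right]$$ (the same sign chosen in numerator and denominator), which is defined by the polynomial $(\zeta_1\zeta_2z)^2B_{\alpha,\beta}(1/z;1/\zeta_1,1/\zeta_2)$, where $$B_{\alpha,\beta}(z;\zeta_1,\zeta_2)=\sigma_1^2-4\sigma_2+(8\alpha+4\beta)\sigma_3-(2\alpha^2+4\alpha\beta)\sigma_1\sigma_3+4\alpha^2\beta\,\sigma_2\sigma_3+(\alpha^4-4\alpha^3\beta)\sigma_3^2$$ and $\sigma_k$ are the elementary symmetric functions of $z,\zeta_1,\zeta_2$. The element $\alpha$ is absorbing, i.e. $\zeta\ast\alpha=\alpha\ast\zeta=[\alpha,\alpha]$ for every $\zeta\in\mathbb{C}P^1\setminus\{\alpha\}$. The product $\alpha\ast\alpha$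 is not defined. Moreover, the element $0$ has an inverse, namely $\mathrm{inv}(0)=0$ and $0\ast0=[\alpha(1-\alpha/(4\beta)),\infty]$, if and only if $\alpha\neq0$.
   Context: $\mathbb{C}P^1=\mathbb{C}\cup\{\infty\}$, $x=x_1/x_0$ for $(x_1:x_0)$, $\infty=(1:0)$. $\mathrm{Sym}^2(X)$ is the set of 2-element multisets of elements of $X$. An algebraic $n$-valued monoid is an algebraic variety $X$ with a rational (possibly only partially defined) morphism $\ast:X\times X\to\mathrm{Sym}^n(X)$ which is associative (the multisets $[x\ast w\mid w\in y\ast z]$ and $[w\ast z\mid w\in x\ast y]$ coincide) and has a neutral element $e$: $x\ast e$ and $e\ast x$ are defined and equal $[x,\dots,x]$ for every $x\in X$. Two such monoids are isomorphic if an isomorphism of varieties carries one multiplication to the other. An inverse of $x$ is an element $x'$ such that $x\ast x'$ and $x'\ast x$ are defined and contain $e$. The operation on $\mathbb{C}P^1$ defined by a polynomial $P(z;x,y)$ of degree at most $2$ in each variable: $(x_1:x_0)\ast(y_1:y_0)$ is the multiset of the two zeros (with multiplicity) in $(z_1:z_0)$ of the form $(x_0y_0z_0)^2P(z_1/z_0;x_1/x_0,y_1/y_0)$; it is undefined where this form vanishes identically. The cubic is parametrized by the slope $m\in\mathbb{C}P^1$ of the line through the node $(\alpha,0)$: $\zeta=m^2+\beta$, $\eta=m(m^2+\beta-\alpha)$ (with $m=\infty$ giving the point $\infty$). The addition of points (chord-tangent law with neutral element $\infty$) is, in this parameter, the partially defined monoid operation $m_1\oplus m_2=\dfrac{m_1m_2+(\alpha-\beta)}{m_1+m_2}$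 on $\mathbb{C}P^1$, defined unless $[m_1,m_2]=[\sqrt{\alpha-\beta},-\sqrt{\alpha-\beta}]$. The involution $\sigma$ is $m\mapsto-m$. Coset construction: for a (1-valued, possibly partially defined) monoid $M$ and a subgroup $H\subset\mathrm{Aut}(M)$ of order $n$, with projection $\pi:M\to M/H$, the coset $n$-valued monoid $M_H$ is $M/H$ with $\pi(u)\ast\pi(v)=[\pi(u\cdot h(v))\mid h\in H]$ and neutral element $\pi(e)$. Here the orbit space is identified with $\mathbb{C}P^1$ via the coordinate $\zeta=m^2+\beta$. When $\beta=0$ (and $\alpha\ne0$) the expression $\alpha(1-\alpha/(4\beta))$ is read as $\infty$. *)

theory Defs
  imports "HOL-Computational_Algebra.Computational_Algebra"
begin

section \<open>The projective line\<close>

datatype cp1 = Aff complex | Infty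

text \<open>Representatives \<open>(x\<^sub>1 : x\<^sub>0)\<close> of points, with \<open>x = x\<^sub>1 / x\<^sub>0\<close>.\<close>

fun hx1 :: "cp1 \<Rightarrow> complex" where
  "hx1 (Aff x) = x"
| "hx1 Infty = 1"

fun hx0 :: "cp1 \<Rightarrow> complex" where
  "hx0 (Aff x) = 1"
| "hx0 Infty = 0"

text \<open>The point \<open>(a : b)\<close>; meaningful only if \<open>a\<close>, \<open>b\<close> are not both zero.\<close>

definition ratio :: "complex \<Rightarrow> complex \<Rightarrow> cp1" where
  "ratio a b = (if b = 0 then Infty else Aff (a / b))"

text \<open>A polynomial \<open>p\<close> of degree at most \<open>n\<close> stands for the binary form
  \<open>\<Sum>i\<le>n. p\<^sub>i z\<^sub>1^i z\<^sub>0^(n-i)\<close>.  The next definition is its multiset of zeros when \<open>p \<noteq> 0\<close>: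
  the form vanishes at \<open>\<infinity>\<close> to order \<open>n - degree p\<close>.\<close>

definition zeros_form :: "nat \<Rightarrow> complex poly \<Rightarrow> cp1 multiset" where
  "zeros_form n p = image_mset Aff (proots p) + replicate_mset (n - degree p) Infty"

definition eval_form :: "nat \<Rightarrow> complex poly \<Rightarrow> cp1 \<Rightarrow> complex" where
  "eval_form d p x = (\<Sum>i\<le>d. coeff p i * hx1 x ^ i * hx0 x ^ (d - i))"

definition regular_cp1 :: "(cp1 \<Rightarrow> cp1) \<Rightarrow> bool" where
  "regular_cp1 \<phi> \<longleftrightarrow> (\<exists>d p q. \<forall>x. (eval_form d p x \<noteq> 0 \<or> eval_form d q x \<noteq> 0) \<and>
     \<phi> x = ratio (eval_form d p x) (eval_form d q x))"

definition cp1_isomorphism :: "(cp1 \<Rightarrow> cp1) \<Rightarrow> bool" where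
  "cp1_isomorphism \<phi> \<longleftrightarrow> bij \<phi> \<and> regular_cp1 \<phi> \<and> regular_cp1 (inv \<phi>)"


section \<open>Multivalued monoids\<close>

text \<open>A partially defined operation has values in an \<open>option\<close> type, \<open>None\<close> meaning ``undefined''.
  The product \<open>x * S\<close> of an element and a multiset is defined if each \<open>x * w\<close>, \<open>w \<in> S\<close>, is.\<close>

definition extend_mset ::
  "('a \<Rightarrow> 'b multiset option) \<Rightarrow> 'a multiset \<Rightarrow> 'b multiset option" where
  "extend_mset g S = (if \<forall>w\<in>#S. g w \<noteq> None
     then Some (\<Sum>w\<in>#S. the (g w)) else None)"

definition nvalued_monoid :: "nat \<Rightarrow> ('a \<Rightarrow> 'a \<Rightarrow> 'a multiset option) \<Rightarrow> 'a \<Rightarrow> bool" where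
  "nvalued_monoid n f e \<longleftrightarrow>
     (\<forall>x y S. f x y = Some S \<longrightarrow> size S = n) \<and>
     (\<forall>x y z. Option.bind (f y z) (extend_mset (f x)) =
              Option.bind (f x y) (extend_mset (\<lambda>w. f w z))) \<and>
     (\<forall>x. f x e = Some (replicate_mset n x) \<and> f e x = Some (replicate_mset n x))"

definition nvalued_inverse ::
  "('a \<Rightarrow> 'a \<Rightarrow> 'a multiset option) \<Rightarrow> 'a \<Rightarrow> 'a \<Rightarrow> 'a \<Rightarrow> bool" where
  "nvalued_inverse f e x x' \<longleftrightarrow>
     (\<exists>S T. f x x' = Some S \<and> e \<in># S \<and> f x' x = Some T \<and> e \<in># T)"

text \<open>A function \<open>c\<close> gives the coefficients of a polynomial
  \<open>P(z;x,y) = \<Sum>i\<le>n. \<Sum>j\<le>d\<^sub>1. \<Sum>k\<le>d\<^sub>2. c i j k z^i x^j y^k\<close>.  For fixed \<open>x\<close> and \<open>y\<close>,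
  \<open>fibre_form\<close> is the binary form
  \<open>x\<^sub>0^d\<^sub>1 y\<^sub>0^d\<^sub>2 z\<^sub>0^n P(z\<^sub>1/z\<^sub>0; x\<^sub>1/x\<^sub>0, y\<^sub>1/y\<^sub>0)\<close> in \<open>z\<close>, dehomogenized.\<close>

definition fibre_form ::
  "nat \<Rightarrow> nat \<Rightarrow> nat \<Rightarrow> (nat \<Rightarrow> nat \<Rightarrow> nat \<Rightarrow> complex) \<Rightarrow> cp1 \<Rightarrow> cp1 \<Rightarrow> complex poly" where
  "fibre_form n d1 d2 c x y = (\<Sum>i\<le>n. monom
     (\<Sum>j\<le>d1. \<Sum>k\<le>d2. c i j k * (hx1 x ^ j * hx0 x ^ (d1 - j)) * (hx1 y ^ k * hx0 y ^ (d2 - k))) i)"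

definition op_of_form ::
  "nat \<Rightarrow> nat \<Rightarrow> nat \<Rightarrow> (nat \<Rightarrow> nat \<Rightarrow> nat \<Rightarrow> complex) \<Rightarrow> cp1 \<Rightarrow> cp1 \<Rightarrow> cp1 multiset option" where
  "op_of_form n d1 d2 c x y = (let p = fibre_form n d1 d2 c x y in
     if p = 0 then None else Some (zeros_form n p))"

text \<open>The variety \<open>Sym\<^sup>n(\<complex>P\<^sup>1)\<close> is the projective space of nonzero binary forms of degree \<open>n\<close>,
  so a map to it is regular near a point iff it is given there by a bihomogeneous family of forms
  that does not vanish at the point.  Multiplying the family by a bihomogeneous function of
  \<open>x\<close> and \<open>y\<close>, one can shrink its nonvanishing locus into any given Zariski neighbourhood of the
  point; hence the following says that the domain is nonempty and Zariski open and that the map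
  is regular on it.\<close>

definition rational_op :: "nat \<Rightarrow> (cp1 \<Rightarrow> cp1 \<Rightarrow> cp1 multiset option) \<Rightarrow> bool" where
  "rational_op n f \<longleftrightarrow> (\<exists>x y. f x y \<noteq> None) \<and>
     (\<forall>x y. f x y \<noteq> None \<longrightarrow> (\<exists>d1 d2 c. op_of_form n d1 d2 c x y \<noteq> None \<and>
        (\<forall>u v S. op_of_form n d1 d2 c u v = Some S \<longrightarrow> f u v = Some S)))"

definition algebraic_nvalued_monoid ::
  "nat \<Rightarrow> (cp1 \<Rightarrow> cp1 \<Rightarrow> cp1 multiset option) \<Rightarrow> cp1 \<Rightarrow> bool" where
  "algebraic_nvalued_monoid n f e \<longleftrightarrow> rational_op n f \<and> nvalued_monoid n f e"

definition nvalued_isomorphic ::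
  "(cp1 \<Rightarrow> cp1 \<Rightarrow> cp1 multiset option) \<Rightarrow> (cp1 \<Rightarrow> cp1 \<Rightarrow> cp1 multiset option) \<Rightarrow> bool" where
  "nvalued_isomorphic f g \<longleftrightarrow> (\<exists>\<phi>. cp1_isomorphism \<phi> \<and>
     (\<forall>x y. g (\<phi> x) (\<phi> y) = map_option (image_mset \<phi>) (f x y)))"


section \<open>The coset construction\<close>

definition partial_monoid :: "('m \<Rightarrow> 'm \<Rightarrow> 'm option) \<Rightarrow> 'm \<Rightarrow> bool" where
  "partial_monoid m e \<longleftrightarrow>
     (\<forall>x y z. Option.bind (m y z) (m x) = Option.bind (m x y) (\<lambda>w. m w z)) \<and>
     (\<forall>x. m x e = Some x \<and> m e x = Some x)"

definition monoid_aut :: "('m \<Rightarrow> 'm \<Rightarrow> 'm option) \<Rightarrow> 'm \<Rightarrow> ('m \<Rightarrow> 'm) set" where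
  "monoid_aut m e = {h. bij h \<and> h e = e \<and> (\<forall>x y. m (h x) (h y) = map_option h (m x y))}"

definition aut_subgroup :: "('m \<Rightarrow> 'm \<Rightarrow> 'm option) \<Rightarrow> 'm \<Rightarrow> ('m \<Rightarrow> 'm) set \<Rightarrow> bool" where
  "aut_subgroup m e H \<longleftrightarrow> H \<subseteq> monoid_aut m e \<and> id \<in> H \<and>
     (\<forall>g\<in>H. \<forall>h\<in>H. g \<circ> h \<in> H) \<and> (\<forall>h\<in>H. inv h \<in> H)"

text \<open>\<open>f\<close> is the multiplication, and \<open>e'\<close> the neutral element, of the coset monoid \<open>M/H\<close>, where
  the orbit space is identified with the type \<open>'x\<close> by means of a surjection \<open>\<pi>\<close> whose fibres are
  the orbits.\<close>

definition coset_monoid ::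
  "nat \<Rightarrow> ('m \<Rightarrow> 'm \<Rightarrow> 'm option) \<Rightarrow> 'm \<Rightarrow> ('m \<Rightarrow> 'm) set \<Rightarrow> ('m \<Rightarrow> 'x) \<Rightarrow>
   ('x \<Rightarrow> 'x \<Rightarrow> 'x multiset option) \<Rightarrow> 'x \<Rightarrow> bool" where
  "coset_monoid n m e H \<pi> f e' \<longleftrightarrow>
     partial_monoid m e \<and> aut_subgroup m e H \<and> finite H \<and> card H = n \<and>
     surj \<pi> \<and> (\<forall>u v. \<pi> u = \<pi> v \<longleftrightarrow> (\<exists>h\<in>H. v = h u)) \<and> e' = \<pi> e \<and>
     (\<forall>u v. f (\<pi> u) (\<pi> v) = (if \<forall>h\<in>H. m u (h v) \<noteq> None
        then Some (image_mset (\<lambda>h. \<pi> (the (m u (h v)))) (mset_set H)) else None))"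


section \<open>The nodal cubic\<close>

text \<open>The cubic, as a set of homogeneous coordinates \<open>(\<xi> : \<zeta> : \<eta>)\<close>.\<close>

definition nodal_cubic :: "complex \<Rightarrow> complex \<Rightarrow> (complex \<times> complex \<times> complex) set" where
  "nodal_cubic \<alpha> \<beta> = {(\<xi>, \<zeta>, \<eta>). (\<xi>, \<zeta>, \<eta>) \<noteq> (0, 0, 0) \<and>
     \<eta>\<^sup>2 * \<xi> = (\<zeta> - \<alpha> * \<xi>)\<^sup>2 * (\<zeta> - \<beta> * \<xi>)}"

text \<open>Its parametrization by slopes: \<open>\<zeta> = m\<^sup>2 + \<beta>\<close>, \<open>\<eta> = m (m\<^sup>2 + \<beta> - \<alpha>)\<close>, as polynomials in \<open>m\<close>.
  It has degree 3, and both square roots of \<open>\<alpha> - \<beta>\<close> are sent to the node.\<close>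

definition zeta_poly :: "complex \<Rightarrow> complex poly" where
  "zeta_poly \<beta> = [:\<beta>, 0, 1:]"

definition eta_poly :: "complex \<Rightarrow> complex \<Rightarrow> complex poly" where
  "eta_poly \<alpha> \<beta> = [:0, \<beta> - \<alpha>, 0, 1:]"

fun slope_point :: "complex \<Rightarrow> complex \<Rightarrow> cp1 \<Rightarrow> complex \<times> complex \<times> complex" where
  "slope_point \<alpha> \<beta> (Aff m) = (1, poly (zeta_poly \<beta>) m, poly (eta_poly \<alpha> \<beta>) m)"
| "slope_point \<alpha> \<beta> Infty = (0, 0, 1)"

text \<open>The line \<open>a \<xi> + b \<zeta> + c \<eta> = 0\<close> meets the cubic, with multiplicities, in the points with
  parameters \<open>m\<^sub>1, m\<^sub>2, m\<^sub>3\<close>: these are the zeros of the pullback of its equation to the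
  parameter line, which is a binary cubic form.\<close>

definition collinear3 :: "complex \<Rightarrow> complex \<Rightarrow> cp1 \<Rightarrow> cp1 \<Rightarrow> cp1 \<Rightarrow> bool" where
  "collinear3 \<alpha> \<beta> m1 m2 m3 \<longleftrightarrow> (\<exists>a b c. (a, b, c) \<noteq> (0, 0, 0) \<and>
     zeros_form 3 ([:a:] + smult b (zeta_poly \<beta>) + smult c (eta_poly \<alpha> \<beta>)) = {#m1, m2, m3#})"

definition third_point :: "complex \<Rightarrow> complex \<Rightarrow> cp1 \<Rightarrow> cp1 \<Rightarrow> cp1 option" where
  "third_point \<alpha> \<beta> m1 m2 = (if \<exists>!m. collinear3 \<alpha> \<beta> m1 m2 m
     then Some (THE m. collinear3 \<alpha> \<beta> m1 m2 m) else None)"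

text \<open>Chord-tangent addition with neutral element \<open>\<infinity>\<close>, in terms of the parameters.\<close>

definition nodal_add :: "complex \<Rightarrow> complex \<Rightarrow> cp1 \<Rightarrow> cp1 \<Rightarrow> cp1 option" where
  "nodal_add \<alpha> \<beta> m1 m2 = Option.bind (third_point \<alpha> \<beta> m1 m2) (third_point \<alpha> \<beta> Infty)"

text \<open>The involution \<open>(\<zeta>, \<eta>) \<mapsto> (\<zeta>, -\<eta>)\<close> and the function \<open>\<zeta>\<close> in terms of the parameter.\<close>

fun nodal_sigma :: "cp1 \<Rightarrow> cp1" where
  "nodal_sigma (Aff m) = Aff (- m)"
| "nodal_sigma Infty = Infty"

fun zeta_coord :: "complex \<Rightarrow> cp1 \<Rightarrow> cp1" where
  "zeta_coord \<beta> (Aff m) = Aff (m\<^sup>2 + \<beta>)"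
| "zeta_coord \<beta> Infty = Infty"

definition node_coset_monoid ::
  "complex \<Rightarrow> complex \<Rightarrow> (cp1 \<Rightarrow> cp1 \<Rightarrow> cp1 multiset option) \<Rightarrow> bool" where
  "node_coset_monoid \<alpha> \<beta> f \<longleftrightarrow>
     coset_monoid 2 (nodal_add \<alpha> \<beta>) Infty {id, nodal_sigma} (zeta_coord \<beta>) f Infty"

definition B_poly :: "complex \<Rightarrow> complex \<Rightarrow> complex \<Rightarrow> complex \<Rightarrow> complex \<Rightarrow> complex" where
  "B_poly \<alpha> \<beta> z x y = (let s1 = z + x + y; s2 = z * x + z * y + x * y; s3 = z * x * y in
     s1\<^sup>2 - 4 * s2 + (8 * \<alpha> + 4 * \<beta>) * s3 - (2 * \<alpha>\<^sup>2 + 4 * \<alpha> * \<beta>) * s1 * s3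
     + 4 * \<alpha>\<^sup>2 * \<beta> * s2 * s3 + (\<alpha> ^ 4 - 4 * \<alpha> ^ 3 * \<beta>) * s3\<^sup>2)"


section \<open>Properties of the slope parametrization and of the addition\<close>

text \<open>The parametrization is onto the cubic, is injective apart from the node, and carries
  \<^const>\<open>nodal_sigma\<close> to the reflection in \<open>\<eta>\<close>; the chord-tangent addition is
  \<open>m\<^sub>1 \<oplus> m\<^sub>2 = (m\<^sub>1 m\<^sub>2 + (\<alpha> - \<beta>)) / (m\<^sub>1 + m\<^sub>2)\<close> in homogeneous coordinates.\<close>

lemma nodal_sigma_point:
  "slope_point \<alpha> \<beta> m = (\<xi>, \<zeta>, \<eta>) \<Longrightarrow>
   slope_point \<alpha> \<beta> (nodal_sigma m) = (if m = Infty then (\<xi>, \<zeta>, \<eta>) else (\<xi>, \<zeta>, - \<eta>))"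
  by (cases m) (auto simp: zeta_poly_def eta_poly_def algebra_simps)

lemma nodal_cubic_slope_point:
  "(\<xi>, \<zeta>, \<eta>) \<in> nodal_cubic \<alpha> \<beta> \<longleftrightarrow>
   (\<exists>m k. k \<noteq> 0 \<and> (\<xi>, \<zeta>, \<eta>) = (case slope_point \<alpha> \<beta> m of (x, y, z) \<Rightarrow> (k * x, k * y, k * z)))"
  (is "?L \<longleftrightarrow> ?R")
proof
  assume L: ?L
  then have eq: "\<eta>\<^sup>2 * \<xi> = (\<zeta> - \<alpha> * \<xi>)\<^sup>2 * (\<zeta> - \<beta> * \<xi>)" and nz: "(\<xi>, \<zeta>, \<eta>) \<noteq> (0, 0, 0)"
    by (auto simp: nodal_cubic_def)
  show ?R
  proof (cases "\<xi> = 0")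
    case True
    with eq nz have "\<zeta> = 0" "\<eta> \<noteq> 0" by auto
    with True show ?thesis by (intro exI[of _ Infty] exI[of _ \<eta>]) auto
  next
    case False
    define z e where "z = \<zeta> / \<xi>" and "e = \<eta> / \<xi>"
    have ze: "\<zeta> = \<xi> * z" "\<eta> = \<xi> * e" using False by (auto simp: z_def e_def)
    have "\<xi> ^ 3 * e\<^sup>2 = \<xi> ^ 3 * ((z - \<alpha>)\<^sup>2 * (z - \<beta>))"
      using eq unfolding ze by (simp add: algebra_simps power2_eq_square power3_eq_cube)
    then have e: "e\<^sup>2 = (z - \<alpha>)\<^sup>2 * (z - \<beta>)" using False by simp
    obtain m where m: "z = m\<^sup>2 + \<beta>" "e = m * (m\<^sup>2 + \<beta> - \<alpha>)"
    proof (cases "z = \<alpha>")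
      case True
      obtain s where s: "s\<^sup>2 = \<alpha> - \<beta>" using power2_csqrt by blast
      have "e = 0" using e True by simp
      with s True show ?thesis by (intro that[of s]) simp_all
    next
      case False
      define m where "m = e / (z - \<alpha>)"
      have "m\<^sup>2 = z - \<beta>" using False e by (simp add: m_def power_divide)
      moreover have "e = m * (z - \<alpha>)" using False by (simp add: m_def)
      ultimately show ?thesis by (intro that[of m]) simp_all
    qed
    show ?thesis using False ze m
      by (intro exI[of _ "Aff m"] exI[of _ \<xi>])
         (auto simp: zeta_poly_def eta_poly_def algebra_simps power2_eq_square)
  qed
next
  assume ?R
  then obtain m k where "k \<noteq> 0"
    "(\<xi>, \<zeta>, \<eta>) = (case slope_point \<alpha> \<beta> m of (x, y, z) \<Rightarrow> (k * x, k * y, k * z))" by blast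
  then show ?L
  proof (cases m)
    case (Aff u)
    then have "\<xi> = k" "\<zeta> = k * (u\<^sup>2 + \<beta>)" "\<eta> = k * (u * (u\<^sup>2 + \<beta> - \<alpha>))"
      using \<open>(\<xi>, \<zeta>, \<eta>) = _\<close>
      by (auto simp: zeta_poly_def eta_poly_def power2_eq_square add_ac diff_add_eq)
    with \<open>k \<noteq> 0\<close> show ?thesis
      by (auto simp: nodal_cubic_def) (simp add: algebra_simps power2_eq_square)
  qed (auto simp: nodal_cubic_def)
qed

lemma slope_point_inj:
  assumes "slope_point \<alpha> \<beta> m = (x, y, z)" and "slope_point \<alpha> \<beta> m' = (k * x, k * y, k * z)"
  shows "m = m' \<or> (\<exists>u v. m = Aff u \<and> m' = Aff v \<and> u\<^sup>2 = \<alpha> - \<beta> \<and> v\<^sup>2 = \<alpha> - \<beta>)"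
proof (cases m; cases m')
  fix u v assume m: "m = Aff u" "m' = Aff v"
  with assms have x: "x = 1" "k = 1" "v\<^sup>2 = u\<^sup>2" "v * (v\<^sup>2 + \<beta> - \<alpha>) = u * (u\<^sup>2 + \<beta> - \<alpha>)"
    by (auto simp: zeta_poly_def eta_poly_def algebra_simps power2_eq_square)
  then have "(v - u) * (u\<^sup>2 + \<beta> - \<alpha>) = 0" by (simp add: algebra_simps)
  then have "v = u \<or> u\<^sup>2 = \<alpha> - \<beta>"
    unfolding mult_eq_0_iff by (auto simp: algebra_simps)
  with x m show ?thesis by auto
qed (use assms in auto)

fun lin :: "cp1 \<Rightarrow> complex poly" where
  "lin (Aff a) = [:- a, 1:]"
| "lin Infty = 1"

lemma lin_nz [simp]: "lin m \<noteq> 0" by (cases m) auto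

lemma zeros_form_lin: "zeros_form (size M) (\<Prod>m\<in>#M. lin m) = M"
proof (induction M)
  case (add m M)
  let ?P = "\<Prod>m\<in>#M. lin m"
  have nz: "?P \<noteq> 0" by (auto simp: prod_mset_zero_iff)
  have "degree ?P \<le> size M"
  proof (induction M)
    case (add m M)
    then show ?case
      using degree_mult_le[of "lin m" "\<Prod>m\<in>#M. lin m"] by (cases m) auto
  qed auto
  with add nz show ?case
    by (cases m)
      (auto simp: zeros_form_def proots_mult degree_mult_eq Suc_diff_le simp del: mult_pCons_left)
qed (auto simp: zeros_form_def)

lemma zeros_form_eq_iff:
  assumes "p \<noteq> 0" "degree p \<le> n"
  shows "zeros_form n p = M \<longleftrightarrow> size M = n \<and> (\<exists>k. k \<noteq> 0 \<and> p = smult k (\<Prod>m\<in>#M. lin m))"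
proof
  assume M: "zeros_form n p = M"
  have "p = smult (lead_coeff p) (\<Prod>m\<in>#M. lin m)"
    using complex_poly_decompose_multiset[of p]
    by (simp add: M[symmetric] zeros_form_def multiset.map_comp comp_def image_replicate_mset)
  moreover have "size M = n"
    using assms by (simp add: M[symmetric] zeros_form_def size_proots_complex)
  ultimately show "size M = n \<and> (\<exists>k. k \<noteq> 0 \<and> p = smult k (\<Prod>m\<in>#M. lin m))"
    using assms by (metis leading_coeff_0_iff)
next
  assume "size M = n \<and> (\<exists>k. k \<noteq> 0 \<and> p = smult k (\<Prod>m\<in>#M. lin m))"
  then obtain k where k: "size M = n" "k \<noteq> 0" "p = smult k (\<Prod>m\<in>#M. lin m)" by auto
  then have "zeros_form n p = zeros_form n (\<Prod>m\<in>#M. lin m)" by (simp add: zeros_form_def)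
  with k show "zeros_form n p = M" using zeros_form_lin by force
qed

lemma collinear3_iff:
  "collinear3 \<alpha> \<beta> m1 m2 m3 \<longleftrightarrow>
   hx1 m3 * (hx1 m1 * hx0 m2 + hx0 m1 * hx1 m2) +
   hx0 m3 * (hx1 m1 * hx1 m2 + (\<alpha> - \<beta>) * hx0 m1 * hx0 m2) = 0"
proof -
  let ?L = "\<lambda>a b c. [:a:] + smult b (zeta_poly \<beta>) + smult c (eta_poly \<alpha> \<beta>)"
  let ?q = "lin m1 * (lin m2 * lin m3)"
  have L: "?L a b c = [:a + b * \<beta>, c * (\<beta> - \<alpha>), b, c:]" for a b c
    by (simp add: zeta_poly_def eta_poly_def)
  have E: "zeros_form 3 (?L a b c) = {#m1, m2, m3#} \<longleftrightarrow> (\<exists>k. k \<noteq> 0 \<and> ?L a b c = smult k ?q)"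
    if "(a, b, c) \<noteq> (0, 0, 0)" for a b c
  proof -
    have "?L a b c \<noteq> 0" "degree (?L a b c) \<le> 3" using that unfolding L by auto
    from zeros_form_eq_iff[OF this] show ?thesis by (auto simp: numeral_3_eq_3)
  qed
  then have "collinear3 \<alpha> \<beta> m1 m2 m3 \<longleftrightarrow>
    (\<exists>a b c. (a, b, c) \<noteq> (0, 0, 0) \<and> (\<exists>k. k \<noteq> 0 \<and> ?L a b c = smult k ?q))"
    unfolding collinear3_def by (intro iff_exI conj_cong refl E)
  also have "\<dots> \<longleftrightarrow> (\<exists>a b c. ?L a b c = ?q)"
  proof
    assume "\<exists>a b c. (a, b, c) \<noteq> (0, 0, 0) \<and> (\<exists>k. k \<noteq> 0 \<and> ?L a b c = smult k ?q)"
    then obtain a b c k where k: "k \<noteq> 0" and e: "?L a b c = smult k ?q" by blast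
    have "?L (a / k) (b / k) (c / k) = smult (1 / k) (?L a b c)"
      unfolding L using k by (auto simp: field_simps)
    also have "\<dots> = ?q" unfolding e using k by simp
    finally show "\<exists>a b c. ?L a b c = ?q" by blast
  next
    assume "\<exists>a b c. ?L a b c = ?q"
    then obtain a b c where e: "?L a b c = ?q" by blast
    have "?q \<noteq> 0" by simp
    with e have "(a, b, c) \<noteq> (0, 0, 0)" by auto
    with e show "\<exists>a b c. (a, b, c) \<noteq> (0, 0, 0) \<and> (\<exists>k. k \<noteq> 0 \<and> ?L a b c = smult k ?q)"
      by (metis one_neq_zero smult_1_left)
  qed
  also have "\<dots> \<longleftrightarrow> coeff ?q 1 = (\<beta> - \<alpha>) * coeff ?q 3"
  proof
    assume "\<exists>a b c. ?L a b c = ?q"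
    then obtain a b c where "?q = [:a + b * \<beta>, c * (\<beta> - \<alpha>), b, c:]" unfolding L by metis
    then show "coeff ?q 1 = (\<beta> - \<alpha>) * coeff ?q 3"
      by (simp only: coeff_pCons) (simp add: eval_nat_numeral)
  next
    assume e: "coeff ?q 1 = (\<beta> - \<alpha>) * coeff ?q 3"
    have d: "degree ?q \<le> 3" 
      by (cases m1; cases m2; cases m3) (auto simp: numeral_3_eq_3 degree_mult_eq)
    have "?q = [:coeff ?q 0, coeff ?q 1, coeff ?q 2, coeff ?q 3:]"
    proof (rule poly_eqI)
      fix i show "coeff ?q i = coeff [:coeff ?q 0, coeff ?q 1, coeff ?q 2, coeff ?q 3:] i"
      proof (cases "i \<le> 3")
        case True
        then have "i = 0 \<or> i = 1 \<or> i = 2 \<or> i = 3" by auto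
        then show ?thesis by (auto simp: eval_nat_numeral)
      next
        case False
        with d show ?thesis
          by (auto simp: coeff_eq_0 coeff_pCons eval_nat_numeral split: nat.splits)
      qed
    qed
    then have "?L (coeff ?q 0 - coeff ?q 2 * \<beta>) (coeff ?q 2) (coeff ?q 3) = ?q"
      unfolding L e by (simp add: mult.commute)
    then show "\<exists>a b c. ?L a b c = ?q" by blast
  qed
  also have "\<dots> \<longleftrightarrow> hx1 m3 * (hx1 m1 * hx0 m2 + hx0 m1 * hx1 m2) +
   hx0 m3 * (hx1 m1 * hx1 m2 + (\<alpha> - \<beta>) * hx0 m1 * hx0 m2) = 0"
    by (cases m1; cases m2; cases m3) (auto simp: eval_nat_numeral algebra_simps neg_eq_iff_add_eq_0)
  finally show ?thesis .
qed

lemma linear_form_zero: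
  "(\<exists>!m. hx1 m * A + hx0 m * B = 0) \<longleftrightarrow> (A, B) \<noteq> (0, 0)"
  "(A, B) \<noteq> (0, 0) \<Longrightarrow> hx1 m * A + hx0 m * B = 0 \<longleftrightarrow> m = ratio (- B) A"
proof -
  show *: "hx1 m * A + hx0 m * B = 0 \<longleftrightarrow> m = ratio (- B) A" if "(A, B) \<noteq> (0, 0)" for m
    using that by (cases m) (auto simp: ratio_def field_simps add_eq_0_iff)
  show "(\<exists>!m. hx1 m * A + hx0 m * B = 0) \<longleftrightarrow> (A, B) \<noteq> (0, 0)"
  proof
    assume ex: "\<exists>!m. hx1 m * A + hx0 m * B = 0"
    show "(A, B) \<noteq> (0, 0)"
    proof
      assume "(A, B) = (0, 0)"
      with ex have "\<exists>!m::cp1. True" by simp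
      then show False by (metis cp1.distinct(1))
    qed
  qed (simp add: *)
qed

lemma third_point_eq:
  "third_point \<alpha> \<beta> m1 m2 =
    (let A = hx1 m1 * hx0 m2 + hx0 m1 * hx1 m2;
         B = hx1 m1 * hx1 m2 + (\<alpha> - \<beta>) * hx0 m1 * hx0 m2
     in if A = 0 \<and> B = 0 then None else Some (ratio (- B) A))"
  unfolding third_point_def collinear3_iff Let_def linear_form_zero(1)
  by (auto simp: linear_form_zero(2))

lemma nodal_add_eq:
  "nodal_add \<alpha> \<beta> m1 m2 =
    (let A = hx1 m1 * hx0 m2 + hx0 m1 * hx1 m2;
         B = hx1 m1 * hx1 m2 + (\<alpha> - \<beta>) * hx0 m1 * hx0 m2
     in if A = 0 \<and> B = 0 then None else Some (ratio B A))"
proof -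
  have "third_point \<alpha> \<beta> Infty m = Some (nodal_sigma m)" for m
    by (cases m) (auto simp: third_point_eq ratio_def)
  then show ?thesis
    by (auto simp: nodal_add_def third_point_eq[of _ _ m1 m2] Let_def ratio_def field_simps)
qed

end

theory Submission
  imports Defs
begin

text \<open>Put \<open>\<gamma> = \<alpha> - \<beta>\<close>.  A slope \<open>(m\<^sub>1 : m\<^sub>0)\<close> is the class, up to complex scalars, of the element
  \<open>m\<^sub>1 + m\<^sub>0 s\<close> of the algebra \<open>\<complex>[s]/(s\<^sup>2 - \<gamma>)\<close>.  In these terms the chord-tangent addition
  \<open>m \<oplus> n = (m n + \<gamma>) / (m + n)\<close> is multiplication in the algebra, undefined exactly when the
  product of representatives is zero; this is why it is an associative partial operation with
  neutral element \<open>\<infinity>\<close>, the class of \<open>1\<close> (\<open>partial_monoid_nodal_add\<close>).  The involution \<open>\<sigma>\<close> is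
  the conjugation \<open>s \<mapsto> - s\<close> on classes, hence an automorphism.

  Associativity of the two-valued operation on the orbits of \<open>\<sigma>\<close> is a general fact on coset
  monoids, true also for partial operations (\<open>coset_monoid_imp_nvalued_monoid\<close>).  The projection to
  the orbit space is onto, so a coset operation is unique.  Its existence and the defining
  polynomial come together: if \<open>\<zeta>\<^sub>1\<close> and \<open>\<zeta>\<^sub>2\<close> have slopes \<open>u\<close> and \<open>v\<close>, then the polynomial of the
  theorem, as a quadratic form in \<open>z\<close>, splits into the linear factors
  \<open>(u + v)\<^sup>2 (z - \<beta>) - (u v + \<gamma>)\<^sup>2\<close> and \<open>(u - v)\<^sup>2 (z - \<beta>) - (u v - \<gamma>)\<^sup>2\<close>
  (\<open>fibre_form_nodal_coeff\<close>), whose zeros are \<open>\<zeta>(u \<oplus> v)\<close> and \<open>\<zeta>(u \<oplus> \<sigma> v)\<close>.  A factor vanishes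
  identically exactly when the corresponding sum is undefined.  Hence the operation defined by the
  polynomial is the coset operation (\<open>node_coset_monoid_iff_form\<close>), and in particular it is rational.

  Multiplying all slopes by \<open>k\<close> turns the addition for \<open>\<gamma>\<close> into the addition for \<open>k\<^sup>2 \<gamma>\<close> and
  commutes with \<open>\<sigma>\<close>.  On the orbits it induces an affine map of \<open>\<zeta>\<close>, and a suitable \<open>k\<close> gives the
  isomorphism between any two members of the family (\<open>node_coset_monoids_isomorphic\<close>).  The
  statements on \<open>\<alpha>\<close> and \<open>0\<close> are read off from the formula with square roots (\<open>node_product_sqrt\<close>):
  the two slopes of the point \<open>\<alpha>\<close>, the square roots of \<open>\<gamma>\<close>, are the classes of the zero divisors,
  and \<open>\<infinity>\<close> lies in the product of finite points \<open>\<zeta>\<^sub>1\<close> and \<open>\<zeta>\<^sub>2\<close> only if \<open>\<zeta>\<^sub>1 = \<zeta>\<^sub>2\<close>.\<close>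

section \<open>Coset monoids\<close>

lemma image_mset_mset_set_eq_sum:
  "finite A \<Longrightarrow> image_mset g (mset_set A) = (\<Sum>a\<in>A. {#g a#})"
  by (induction A rule: finite_induct) auto

lemma extend_mset_image_mset_set:
  assumes "finite A"
  shows "extend_mset g (image_mset t (mset_set A)) =
    (if \<forall>a\<in>A. g (t a) \<noteq> None then Some (\<Sum>a\<in>A. the (g (t a))) else None)"
  using assms
  by (simp add: extend_mset_def sum_unfold_sum_mset multiset.map_comp comp_def)

lemma coset_monoid_product:
  assumes "coset_monoid n m e H \<pi> f e'"
  shows "f (\<pi> u) (\<pi> v) = (if \<forall>h\<in>H. m u (h v) \<noteq> None
    then Some (image_mset (\<lambda>h. \<pi> (the (m u (h v)))) (mset_set H)) else None)"
  using assms unfolding coset_monoid_def by blast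

lemma coset_monoid_unique:
  assumes f: "coset_monoid n m e H \<pi> f e'" and g: "coset_monoid n m e H \<pi> g e''"
  shows "f = g"
proof (intro ext)
  fix x y
  have "surj \<pi>" using f by (simp add: coset_monoid_def)
  then obtain u v where "x = \<pi> u" "y = \<pi> v" by (metis surjD)
  then show "f x y = g x y"
    using coset_monoid_product[OF f] coset_monoid_product[OF g] by simp
qed

text \<open>Both bracketings are families indexed by pairs of group elements.  As \<open>k\<close> is an automorphism,
  \<open>u \<cdot> k (v \<cdot> h w) = u \<cdot> (k v \<cdot> (k \<circ> h) w) = (u \<cdot> k v) \<cdot> (k \<circ> h) w\<close>, so the substitution
  \<open>l = k \<circ> h\<close> matches the two families.  Since partial values are compared, the domains match
  as well.\<close>

lemma coset_monoid_associative:
  assumes M: "coset_monoid n m e H \<pi> f e'"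
  shows "Option.bind (f (\<pi> v) (\<pi> w)) (extend_mset (f (\<pi> u))) =
         Option.bind (f (\<pi> u) (\<pi> v)) (extend_mset (\<lambda>x. f x (\<pi> w)))"
proof -
  note prod = coset_monoid_product[OF M]
  have fin: "finite H" and id: "id \<in> H"
    and comp: "\<And>g h. g \<in> H \<Longrightarrow> h \<in> H \<Longrightarrow> g \<circ> h \<in> H" and inv: "\<And>h. h \<in> H \<Longrightarrow> inv h \<in> H"
    and aut: "H \<subseteq> monoid_aut m e"
    and assoc: "\<And>x y z. Option.bind (m y z) (m x) = Option.bind (m x y) (\<lambda>w. m w z)"
    using M by (auto simp: coset_monoid_def aut_subgroup_def partial_monoid_def)
  have bij: "bij h" and hom: "m (h x) (h y) = map_option h (m x y)" if "h \<in> H" for h x y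
    using aut that by (auto simp: monoid_aut_def)
  define L where "L h k = Option.bind (m v (h w)) (\<lambda>x. m u (k x))" for h k
  define R where "R k l = Option.bind (m u (k v)) (\<lambda>x. m x (l w))" for k l
  have LR: "L h k = R k (k \<circ> h)" if "k \<in> H" for h k
  proof -
    have "L h k = Option.bind (m (k v) (k (h w))) (m u)"
      unfolding L_def hom[OF that] by (cases "m v (h w)") auto
    then show ?thesis by (simp add: assoc R_def)
  qed
  have translate: "bij_betw (\<lambda>h. k \<circ> h) H H" if k: "k \<in> H" for k
  proof (rule bij_betw_byWitness[where f' = "\<lambda>l. inv k \<circ> l"])
    have "inv k \<circ> k = id" "k \<circ> inv k = id"
      using bij[OF k] by (metis bij_is_inj inv_o_cancel, metis bij_is_surj surj_iff)
    then show "\<forall>a\<in>H. inv k \<circ> (k \<circ> a) = a" "\<forall>a\<in>H. k \<circ> (inv k \<circ> a) = a"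
      by (simp_all flip: comp_assoc)
  qed (use k comp inv in auto)
  have dom: "(\<forall>h\<in>H. \<forall>k\<in>H. L h k \<noteq> None) \<longleftrightarrow> (\<forall>k\<in>H. \<forall>l\<in>H. R k l \<noteq> None)"
  proof -
    \<comment> \<open>\<open>k \<circ> h\<close> runs over the whole group when \<open>h\<close> does\<close>
    have "(\<forall>h\<in>H. R k (k \<circ> h) \<noteq> None) \<longleftrightarrow> (\<forall>l\<in>H. R k l \<noteq> None)" if "k \<in> H" for k
      using bij_betw_imp_surj_on[OF translate[OF that]] by (metis imageE imageI)
    then show ?thesis using LR by metis
  qed
  have left: "Option.bind (f (\<pi> v) (\<pi> w)) (extend_mset (f (\<pi> u))) =
    (if \<forall>h\<in>H. \<forall>k\<in>H. L h k \<noteq> None then Some (\<Sum>h\<in>H. \<Sum>k\<in>H. {#\<pi> (the (L h k))#}) else None)"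
  proof (cases "\<forall>h\<in>H. m v (h w) \<noteq> None")
    case True
    then have L: "L h k = m u (k (the (m v (h w))))" if "h \<in> H" for h k
      using that by (force simp: L_def)
    show ?thesis
      unfolding prod[of v w] using True fin
      by (simp add: extend_mset_image_mset_set prod)
        (auto simp: L image_mset_mset_set_eq_sum intro!: sum.cong)
  next
    case False
    then obtain h where "h \<in> H" "m v (h w) = None" by blast
    \<comment> \<open>if an inner product is undefined, so is every product containing it\<close>
    then have "L h id = None" by (simp add: L_def)
    with id \<open>h \<in> H\<close> have "\<exists>h\<in>H. \<exists>k\<in>H. L h k = None" by blast
    with False show ?thesis unfolding prod by auto
  qed
  have right: "Option.bind (f (\<pi> u) (\<pi> v)) (extend_mset (\<lambda>x. f x (\<pi> w))) =
    (if \<forall>k\<in>H. \<forall>l\<in>H. R k l \<noteq> None then Some (\<Sum>k\<in>H. \<Sum>l\<in>H. {#\<pi> (the (R k l))#}) else None)"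
  proof (cases "\<forall>k\<in>H. m u (k v) \<noteq> None")
    case True
    then have R: "R k l = m (the (m u (k v))) (l w)" if "k \<in> H" for k l
      using that by (force simp: R_def)
    show ?thesis
      unfolding prod[of u v] using True fin
      by (simp add: extend_mset_image_mset_set prod)
        (auto simp: R image_mset_mset_set_eq_sum intro!: sum.cong)
  next
    case False
    then obtain k where "k \<in> H" "m u (k v) = None" by blast
    then have "R k id = None" by (simp add: R_def)
    with id \<open>k \<in> H\<close> have "\<exists>k\<in>H. \<exists>l\<in>H. R k l = None" by blast
    with False show ?thesis unfolding prod by auto
  qed
  have "(\<Sum>h\<in>H. \<Sum>k\<in>H. {#\<pi> (the (L h k))#}) = (\<Sum>k\<in>H. \<Sum>h\<in>H. {#\<pi> (the (R k (k \<circ> h)))#})"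
    by (subst sum.swap) (simp add: LR)
  also have "\<dots> = (\<Sum>k\<in>H. \<Sum>l\<in>H. {#\<pi> (the (R k l))#})"
    by (intro sum.cong refl sum.reindex_bij_betw[OF translate])
  finally show ?thesis unfolding left right dom by simp
qed

lemma coset_monoid_imp_nvalued_monoid:
  assumes M: "coset_monoid n m e H \<pi> f e'"
  shows "nvalued_monoid n f e'"
proof -
  note prod = coset_monoid_product[OF M]
  have fin: "finite H" and card: "card H = n" and e': "e' = \<pi> e" and surj: "surj \<pi>"
    and orbit: "\<And>u v. \<pi> u = \<pi> v \<longleftrightarrow> (\<exists>h\<in>H. v = h u)"
    and aut: "H \<subseteq> monoid_aut m e"
    and unit: "\<And>x. m x e = Some x" "\<And>x. m e x = Some x"
    using M by (auto simp: coset_monoid_def aut_subgroup_def partial_monoid_def)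
  have fixes_e: "h e = e" if "h \<in> H" for h using aut that by (auto simp: monoid_aut_def)
  have orbit': "\<pi> (h u) = \<pi> u" if "h \<in> H" for h u using orbit that by metis
  have const: "image_mset g (mset_set H) = replicate_mset n c" if "\<And>h. h \<in> H \<Longrightarrow> g h = c" for g c
  proof -
    have "image_mset g (mset_set H) = image_mset (\<lambda>_. c) (mset_set H)"
      using fin that by (intro image_mset_cong) auto
    then show ?thesis by (simp add: image_mset_const_eq card)
  qed
  show ?thesis unfolding nvalued_monoid_def
  proof (intro conjI allI impI)
    fix x y S assume "f x y = Some S"
    moreover obtain u v where "x = \<pi> u" "y = \<pi> v" using surj by (metis surjD)
    ultimately show "size S = n" using card by (auto simp: prod split: if_splits)
  next
    fix x y z
    obtain u v w where "x = \<pi> u" "y = \<pi> v" "z = \<pi> w" using surj by (metis surjD)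
    then show "Option.bind (f y z) (extend_mset (f x)) =
      Option.bind (f x y) (extend_mset (\<lambda>w. f w z))"
      using coset_monoid_associative[OF M] by simp
  next
    fix x
    obtain u where x: "x = \<pi> u" using surj by (metis surjD)
    show "f x e' = Some (replicate_mset n x)"
      unfolding x e' prod by (auto simp: fixes_e unit intro!: const)
    show "f e' x = Some (replicate_mset n x)"
      unfolding x e' prod by (auto simp: orbit' unit intro!: const)
  qed
qed

text \<open>An equivariant homomorphism \<open>\<psi>\<close> of partial monoids that preserves and reflects definedness
  descends to the orbit spaces.\<close>

lemma coset_monoid_hom:
  assumes f: "coset_monoid n m e H \<pi> f e'" and g: "coset_monoid n' m' e1 H \<pi>' g e1'"
    and hom: "\<And>u v. m' (\<psi> u) (\<psi> v) = map_option \<psi> (m u v)"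
    and comm: "\<And>h u. h \<in> H \<Longrightarrow> \<psi> (h u) = h (\<psi> u)"
    and proj: "\<And>u. \<phi> (\<pi> u) = \<pi>' (\<psi> u)"
  shows "g (\<phi> x) (\<phi> y) = map_option (image_mset \<phi>) (f x y)"
proof -
  have fin: "finite H" and "surj \<pi>" using f by (auto simp: coset_monoid_def)
  then obtain u v where x: "x = \<pi> u" "y = \<pi> v" by (metis surjD)
  have eq: "m' (\<psi> u) (h (\<psi> v)) = map_option \<psi> (m u (h v))" if "h \<in> H" for h
    using comm[OF that, of v] hom[of u "h v"] by simp
  show ?thesis
    unfolding x proj coset_monoid_product[OF f] coset_monoid_product[OF g]
    using fin eq by (auto simp: multiset.map_comp comp_def proj option.map_sel intro!: image_mset_cong)
qed


section \<open>Points and zeros in homogeneous coordinates\<close>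

lemma hx_ratio:
  assumes "a \<noteq> 0 \<or> b \<noteq> 0"
  obtains k where "k \<noteq> 0" "hx1 (ratio a b) = k * a" "hx0 (ratio a b) = k * b"
proof
  show "(if b = 0 then 1 / a else 1 / b) \<noteq> 0" using assms by auto
qed (use assms in \<open>auto simp: ratio_def\<close>)

lemma ratio_scale: "k \<noteq> 0 \<Longrightarrow> ratio (k * a) (k * b) = ratio a b"
  by (auto simp: ratio_def)

lemma linear_poly_eq_lin:
  assumes "p \<noteq> 0 \<or> q \<noteq> 0"
  obtains k where "k \<noteq> 0" "[:- p, q:] = smult k (lin (ratio p q))"
proof
  show "(if q = 0 then - p else q) \<noteq> 0" using assms by auto
qed (use assms in \<open>auto simp: ratio_def\<close>)

text \<open>Since zeros at infinity are counted, a factor may be constant; each is a nonzero multiple of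
  the standard form \<open>lin\<close> vanishing at its root.\<close>

lemma zeros_form_mult_linear:
  assumes "p \<noteq> 0 \<or> q \<noteq> 0" "p' \<noteq> 0 \<or> q' \<noteq> 0"
  shows "zeros_form 2 ([:- p, q:] * [:- p', q':]) = {#ratio p q, ratio p' q'#}"
proof -
  obtain k where k: "k \<noteq> 0" "[:- p, q:] = smult k (lin (ratio p q))"
    using linear_poly_eq_lin[OF assms(1)] .
  obtain k' where k': "k' \<noteq> 0" "[:- p', q':] = smult k' (lin (ratio p' q'))"
    using linear_poly_eq_lin[OF assms(2)] .
  let ?P = "[:- p, q:] * [:- p', q':]"
  have P: "?P = smult (k * k') (\<Prod>m\<in>#{#ratio p q, ratio p' q'#}. lin m)"
    unfolding k k' by (simp add: mult.commute)
  have "?P \<noteq> 0" unfolding k k' using k(1) k'(1) by simp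
  moreover have "degree ?P \<le> 2"
    using degree_mult_le[of "[:- p, q:]" "[:- p', q':]"] by (auto split: if_splits)
  ultimately have "zeros_form 2 ?P = M \<longleftrightarrow>
    size M = 2 \<and> (\<exists>c. c \<noteq> 0 \<and> ?P = smult c (\<Prod>m\<in>#M. lin m))" for M
    by (rule zeros_form_eq_iff)
  moreover have "size {#ratio p q, ratio p' q'#} = 2" "k * k' \<noteq> 0"
    using k(1) k'(1) by simp_all
  ultimately show ?thesis using P by blast
qed


section \<open>The addition of slopes\<close>

text \<open>The formula for the addition is bihomogeneous, so any homogeneous coordinates of the first
  summand can be used in place of the normalized ones.\<close>

lemma nodal_add_ratio:
  assumes "b \<noteq> 0 \<or> a \<noteq> 0"
  shows "nodal_add \<alpha> \<beta> (ratio b a) m =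
    (let A = b * hx0 m + a * hx1 m; B = b * hx1 m + (\<alpha> - \<beta>) * a * hx0 m
     in if A = 0 \<and> B = 0 then None else Some (ratio B A))"
proof -
  obtain k where k: "k \<noteq> 0" "hx1 (ratio b a) = k * b" "hx0 (ratio b a) = k * a"
    using hx_ratio[OF assms] .
  have "k * b * hx0 m + k * a * hx1 m = k * (b * hx0 m + a * hx1 m)"
    "k * b * hx1 m + (\<alpha> - \<beta>) * (k * a) * hx0 m = k * (b * hx1 m + (\<alpha> - \<beta>) * a * hx0 m)"
    by (simp_all add: algebra_simps)
  then show ?thesis
    by (simp only: nodal_add_eq k Let_def ratio_scale[OF k(1)] mult_eq_0_iff) (simp add: k(1))
qed

lemma nodal_add_commute: "nodal_add \<alpha> \<beta> x y = nodal_add \<alpha> \<beta> y x"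
  by (simp add: nodal_add_eq mult.commute add.commute mult.left_commute mult.assoc)

text \<open>The class of the product of three elements \<open>x\<^sub>1 + x\<^sub>0 s\<close>, \<open>y\<^sub>1 + y\<^sub>0 s\<close>, \<open>z\<^sub>1 + z\<^sub>0 s\<close> of
  \<open>\<complex>[s]/(s\<^sup>2 - (\<alpha> - \<beta>))\<close>.  It is visibly symmetric, which with commutativity gives associativity.\<close>

definition nodal_add3 :: "complex \<Rightarrow> complex \<Rightarrow> cp1 \<Rightarrow> cp1 \<Rightarrow> cp1 \<Rightarrow> cp1 option" where
  "nodal_add3 \<alpha> \<beta> x y z =
    (let A = (hx1 x * hx1 y * hx0 z + hx1 x * hx0 y * hx1 z + hx0 x * hx1 y * hx1 z) +
             (\<alpha> - \<beta>) * hx0 x * hx0 y * hx0 z;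
         B = hx1 x * hx1 y * hx1 z + (\<alpha> - \<beta>) *
             (hx1 x * hx0 y * hx0 z + hx0 x * hx1 y * hx0 z + hx0 x * hx0 y * hx1 z)
     in if A = 0 \<and> B = 0 then None else Some (ratio B A))"

text \<open>When the inner sum is undefined, the product of the first two elements is zero, hence so is
  the product of all three; thus the triple product also accounts for the domain.\<close>

lemma nodal_add_twice:
  "Option.bind (nodal_add \<alpha> \<beta> x y) (\<lambda>w. nodal_add \<alpha> \<beta> w z) = nodal_add3 \<alpha> \<beta> x y z"
proof -
  define A where "A = hx1 x * hx0 y + hx0 x * hx1 y"
  define B where "B = hx1 x * hx1 y + (\<alpha> - \<beta>) * hx0 x * hx0 y"
  have 3: "nodal_add3 \<alpha> \<beta> x y z =
    (let A' = B * hx0 z + A * hx1 z; B' = B * hx1 z + (\<alpha> - \<beta>) * A * hx0 z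
     in if A' = 0 \<and> B' = 0 then None else Some (ratio B' A'))"
    by (simp add: nodal_add3_def A_def B_def algebra_simps)
  have 2: "nodal_add \<alpha> \<beta> x y = (if A = 0 \<and> B = 0 then None else Some (ratio B A))"
    by (simp add: nodal_add_eq A_def B_def Let_def)
  show ?thesis
  proof (cases "A = 0 \<and> B = 0")
    case True
    then show ?thesis by (simp add: 2 3)
  next
    case False
    then show ?thesis using nodal_add_ratio[of B A \<alpha> \<beta> z] by (auto simp: 2 3)
  qed
qed

lemma partial_monoid_nodal_add: "partial_monoid (nodal_add \<alpha> \<beta>) Infty"
proof -
  have unit: "nodal_add \<alpha> \<beta> x Infty = Some x" for x
    by (cases x) (auto simp: nodal_add_eq ratio_def)
  have "Option.bind (nodal_add \<alpha> \<beta> y z) (nodal_add \<alpha> \<beta> x) =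
    Option.bind (nodal_add \<alpha> \<beta> x y) (\<lambda>w. nodal_add \<alpha> \<beta> w z)" for x y z
  proof -
    have "Option.bind (nodal_add \<alpha> \<beta> y z) (nodal_add \<alpha> \<beta> x) =
      Option.bind (nodal_add \<alpha> \<beta> y z) (\<lambda>w. nodal_add \<alpha> \<beta> w x)"
      using nodal_add_commute by metis
    also have "\<dots> = nodal_add3 \<alpha> \<beta> x y z"
      unfolding nodal_add_twice by (simp add: nodal_add3_def algebra_simps)
    finally show ?thesis by (simp add: nodal_add_twice)
  qed
  with unit show ?thesis
    unfolding partial_monoid_def using nodal_add_commute by metis
qed

text \<open>Multiplication by \<open>- 1\<close> is the involution \<open>\<sigma>\<close>, and other factors relate cubics with
  different parameters.\<close>

definition scale_slope :: "complex \<Rightarrow> cp1 \<Rightarrow> cp1" where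
  "scale_slope k m = ratio (k * hx1 m) (hx0 m)"

lemma nodal_sigma_eq_scale: "nodal_sigma = scale_slope (- 1)"
proof
  fix m show "nodal_sigma m = scale_slope (- 1) m"
    by (cases m) (auto simp: scale_slope_def ratio_def)
qed

lemma scale_slope_scale_slope: "k \<noteq> 0 \<Longrightarrow> scale_slope j (scale_slope k m) = scale_slope (j * k) m"
  by (cases m) (auto simp: scale_slope_def ratio_def)

text \<open>The expression \<open>(u v + \<gamma>) / (u + v)\<close> is homogeneous of degree 1 when \<open>\<gamma>\<close> has degree 2.\<close>

lemma nodal_add_scale_slope:
  assumes "k \<noteq> 0" and "\<alpha>' - \<beta>' = k\<^sup>2 * (\<alpha> - \<beta>)"
  shows "nodal_add \<alpha>' \<beta>' (scale_slope k u) (scale_slope k v) =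
    map_option (scale_slope k) (nodal_add \<alpha> \<beta> u v)"
proof (cases u; cases v)
  fix a b assume uv: "u = Aff a" "v = Aff b"
  have "k * a * (k * b) + (\<alpha>' - \<beta>') = k * (k * (a * b + (\<alpha> - \<beta>)))" "k * a + k * b = k * (a + b)"
    unfolding assms(2) by (simp_all add: algebra_simps power2_eq_square)
  with uv assms(1) show ?thesis
    by (auto simp: nodal_add_eq scale_slope_def ratio_def Let_def add_eq_0_iff)
qed (use assms(1) in \<open>auto simp: nodal_add_eq scale_slope_def ratio_def\<close>)

lemma aut_subgroup_nodal_sigma:
  "aut_subgroup (nodal_add \<alpha> \<beta>) Infty {id, nodal_sigma}"
proof -
  have invol: "nodal_sigma \<circ> nodal_sigma = id"
  proof
    fix m show "(nodal_sigma \<circ> nodal_sigma) m = id m" by (cases m) auto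
  qed
  then have "bij nodal_sigma" "inv nodal_sigma = nodal_sigma"
    using o_bij inv_unique_comp by blast+
  moreover have "nodal_add \<alpha> \<beta> (nodal_sigma u) (nodal_sigma v) =
    map_option nodal_sigma (nodal_add \<alpha> \<beta> u v)" for u v
    unfolding nodal_sigma_eq_scale by (rule nodal_add_scale_slope) auto
  ultimately show ?thesis
    using invol by (auto simp: aut_subgroup_def monoid_aut_def option.map_id)
qed

text \<open>The sign of the numerator will be lost after squaring in \<open>\<zeta> = m\<^sup>2 + \<beta>\<close>; the point of this form
  is that it is uniform in the finite and infinite slopes.\<close>

lemma nodal_add_sigma:
  "nodal_add \<alpha> \<beta> u (nodal_sigma v) =
    (let A = hx1 u * hx0 v - hx0 u * hx1 v; B = hx1 u * hx1 v - (\<alpha> - \<beta>) * hx0 u * hx0 v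
     in if A = 0 \<and> B = 0 then None else Some (ratio (- B) A))"
  by (cases v) (auto simp: nodal_add_eq ratio_def Let_def algebra_simps)

lemma zeta_coord_ratio:
  "zeta_coord \<beta> (ratio b a) = ratio (b\<^sup>2 + \<beta> * a\<^sup>2) (a\<^sup>2)"
  by (auto simp: ratio_def field_simps)

lemma zeta_coord_ratio_minus: "zeta_coord \<beta> (ratio (- b) a) = zeta_coord \<beta> (ratio b a)"
  by (simp add: zeta_coord_ratio)

lemma zeta_coord_eq_iff:
  "zeta_coord \<beta> u = zeta_coord \<beta> v \<longleftrightarrow> (\<exists>h\<in>{id, nodal_sigma}. v = h u)"
proof (cases u; cases v)
  fix a b assume uv: "u = Aff a" "v = Aff b"
  have "a\<^sup>2 = b\<^sup>2 \<longleftrightarrow> b = a \<or> b = - a"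
    using power2_eq_iff[of b a] by (simp add: eq_commute[of "a\<^sup>2"])
  with uv show ?thesis by simp
qed auto

lemma surj_zeta_coord: "surj (zeta_coord \<beta>)"
proof (rule surjI)
  fix x :: cp1
  show "zeta_coord \<beta> (case x of Infty \<Rightarrow> Infty | Aff z \<Rightarrow> Aff (csqrt (z - \<beta>))) = x"
    by (cases x) auto
qed

lemma id_neq_nodal_sigma: "id \<noteq> nodal_sigma"
proof
  assume "id = nodal_sigma"
  then have "id (Aff 1) = nodal_sigma (Aff 1)" by (rule fun_cong)
  then show False by simp
qed


section \<open>The two-valued product\<close>

text \<open>The two values \<open>\<zeta>(u \<oplus> v)\<close> and \<open>\<zeta>(u \<oplus> \<sigma> v)\<close>, as a function of the slopes.\<close>

definition nodal_product :: "complex \<Rightarrow> complex \<Rightarrow> cp1 \<Rightarrow> cp1 \<Rightarrow> cp1 multiset option" where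
  "nodal_product \<alpha> \<beta> u v =
    (let A = hx1 u * hx0 v + hx0 u * hx1 v; B = hx1 u * hx1 v + (\<alpha> - \<beta>) * hx0 u * hx0 v;
         A' = hx1 u * hx0 v - hx0 u * hx1 v; B' = hx1 u * hx1 v - (\<alpha> - \<beta>) * hx0 u * hx0 v
     in if A = 0 \<and> B = 0 \<or> A' = 0 \<and> B' = 0 then None
        else Some {#zeta_coord \<beta> (ratio B A), zeta_coord \<beta> (ratio B' A')#})"

lemma node_coset_monoid_iff:
  "node_coset_monoid \<alpha> \<beta> f \<longleftrightarrow>
   (\<forall>u v. f (zeta_coord \<beta> u) (zeta_coord \<beta> v) = nodal_product \<alpha> \<beta> u v)"
proof -
  have "(if \<forall>h\<in>{id, nodal_sigma}. nodal_add \<alpha> \<beta> u (h v) \<noteq> None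
         then Some (image_mset (\<lambda>h. zeta_coord \<beta> (the (nodal_add \<alpha> \<beta> u (h v))))
                (mset_set {id, nodal_sigma})) else None) = nodal_product \<alpha> \<beta> u v" for u v
    using id_neq_nodal_sigma
    by (auto simp: nodal_product_def nodal_add_sigma Let_def zeta_coord_ratio_minus
          nodal_add_eq[of \<alpha> \<beta> u v] simp del: minus_diff_eq)
  then show ?thesis
    using partial_monoid_nodal_add aut_subgroup_nodal_sigma surj_zeta_coord zeta_coord_eq_iff
      id_neq_nodal_sigma
    unfolding node_coset_monoid_def coset_monoid_def by auto
qed

text \<open>With \<open>e\<^sub>k\<close> the elementary symmetric functions of \<open>z, x, y\<close>, these are the coefficients of
  \<open>e\<^sub>2\<^sup>2 - 4 e\<^sub>1 e\<^sub>3 + a e\<^sub>3 + b e\<^sub>2 + c e\<^sub>1 + d\<close>, where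
  \<open>e\<^sub>2\<^sup>2 - 4 e\<^sub>1 e\<^sub>3 = x\<^sup>2 y\<^sup>2 + y\<^sup>2 z\<^sup>2 + z\<^sup>2 x\<^sup>2 - 2 x y z (x + y + z)\<close>.  The substitution of
  reciprocals turns \<open>\<sigma>\<^sub>1, \<sigma>\<^sub>2, \<sigma>\<^sub>3\<close> into \<open>e\<^sub>2 / e\<^sub>3, e\<^sub>1 / e\<^sub>3, 1 / e\<^sub>3\<close>, so multiplying \<open>B\<close> by
  \<open>e\<^sub>3\<^sup>2\<close> gives this polynomial.\<close>

definition nodal_coeff :: "complex \<Rightarrow> complex \<Rightarrow> nat \<Rightarrow> nat \<Rightarrow> nat \<Rightarrow> complex" where
  "nodal_coeff \<alpha> \<beta> i j k =
    (let a = 8 * \<alpha> + 4 * \<beta>; b = - (2 * \<alpha>\<^sup>2 + 4 * \<alpha> * \<beta>); c = 4 * \<alpha>\<^sup>2 * \<beta>; d = \<alpha> ^ 4 - 4 * \<alpha> ^ 3 * \<beta>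
     in [[[d, c, 0], [c,  b,  0], [0,  0, 1]],
         [[c, b, 0], [b,  a, -2], [0, -2, 0]],
         [[0, 0, 1], [0, -2,  0], [1,  0, 0]]] ! i ! j ! k)"

text \<open>Leaving \<open>X\<close> and \<open>Y\<close> arbitrary lets the same expansion serve for the powers of numbers
  and for the monomials in homogeneous coordinates.\<close>

lemma nodal_coeff_sum:
  fixes X Y :: "nat \<Rightarrow> complex"
  shows "(\<Sum>j\<le>2. \<Sum>k\<le>2. nodal_coeff \<alpha> \<beta> 0 j k * X j * Y k) =
      (\<alpha> ^ 4 - 4 * \<alpha> ^ 3 * \<beta>) * (X 0 * Y 0) + 4 * \<alpha>\<^sup>2 * \<beta> * (X 0 * Y 1 + X 1 * Y 0)
      - (2 * \<alpha>\<^sup>2 + 4 * \<alpha> * \<beta>) * (X 1 * Y 1) + X 2 * Y 2"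
    "(\<Sum>j\<le>2. \<Sum>k\<le>2. nodal_coeff \<alpha> \<beta> 1 j k * X j * Y k) =
      4 * \<alpha>\<^sup>2 * \<beta> * (X 0 * Y 0) - (2 * \<alpha>\<^sup>2 + 4 * \<alpha> * \<beta>) * (X 0 * Y 1 + X 1 * Y 0)
      + (8 * \<alpha> + 4 * \<beta>) * (X 1 * Y 1) - 2 * (X 1 * Y 2 + X 2 * Y 1)"
    "(\<Sum>j\<le>2. \<Sum>k\<le>2. nodal_coeff \<alpha> \<beta> 2 j k * X j * Y k) =
      X 0 * Y 2 - 2 * (X 1 * Y 1) + X 2 * Y 0"
  by (simp_all add: nodal_coeff_def Let_def numeral_2_eq_2) (simp_all add: algebra_simps)

lemma nodal_coeff_B_poly:
  assumes "z \<noteq> 0" "x \<noteq> 0" "y \<noteq> 0"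
  shows "(\<Sum>i\<le>2. \<Sum>j\<le>2. \<Sum>k\<le>2. nodal_coeff \<alpha> \<beta> i j k * z ^ i * x ^ j * y ^ k) =
    (x * y * z)\<^sup>2 * B_poly \<alpha> \<beta> (1 / z) (1 / x) (1 / y)"
proof -
  have inv: "1 / z + 1 / x + 1 / y = (x * y + z * y + z * x) / (x * y * z)"
    "1 / z * (1 / x) + 1 / z * (1 / y) + 1 / x * (1 / y) = (x + y + z) / (x * y * z)"
    "1 / z * (1 / x) * (1 / y) = 1 / (x * y * z)"
    using assms by (simp_all add: field_simps)
  define e where "e = x * y * z"
  have "e \<noteq> 0" using assms by (simp add: e_def)
  have clear: "e\<^sup>2 * ((s / e)\<^sup>2 - 4 * (t / e) + a * (1 / e) - b * (s / e) * (1 / e)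
      + c * (t / e) * (1 / e) + d * (1 / e)\<^sup>2) = s\<^sup>2 - 4 * t * e + a * e - b * s + c * t + d"
    for s t a b c d
    using \<open>e \<noteq> 0\<close> by (simp add: field_simps power2_eq_square)
  have "(\<Sum>i\<le>2. \<Sum>j\<le>2. \<Sum>k\<le>2. nodal_coeff \<alpha> \<beta> i j k * z ^ i * x ^ j * y ^ k) =
    (\<Sum>i\<le>2. (\<Sum>j\<le>2. \<Sum>k\<le>2. nodal_coeff \<alpha> \<beta> i j k * x ^ j * y ^ k) * z ^ i)"
    unfolding sum_distrib_right by (intro sum.cong refl) (simp only: mult_ac)
  also have "\<dots> = (\<Sum>j\<le>2. \<Sum>k\<le>2. nodal_coeff \<alpha> \<beta> 0 j k * x ^ j * y ^ k)
    + (\<Sum>j\<le>2. \<Sum>k\<le>2. nodal_coeff \<alpha> \<beta> 1 j k * x ^ j * y ^ k) * z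
    + (\<Sum>j\<le>2. \<Sum>k\<le>2. nodal_coeff \<alpha> \<beta> 2 j k * x ^ j * y ^ k) * z\<^sup>2"
    unfolding numeral_2_eq_2 sum.atMost_Suc by simp
  also have "\<dots> = (x * y * z)\<^sup>2 * B_poly \<alpha> \<beta> (1 / z) (1 / x) (1 / y)"
    unfolding B_poly_def Let_def inv e_def[symmetric] clear nodal_coeff_sum
    unfolding e_def power_0 power_one_right by algebra
  finally show ?thesis .
qed

text \<open>The key factorization: the zeros of the two factors are \<open>\<zeta>(u \<oplus> v)\<close> and \<open>\<zeta>(u \<oplus> \<sigma> v)\<close>.
  Homogeneous coordinates cover the infinite slopes and the degenerate factors as well.\<close>

lemma fibre_form_nodal_coeff:
  fixes \<alpha> \<beta> :: complex and u v :: cp1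
  defines "A \<equiv> hx1 u * hx0 v + hx0 u * hx1 v"
    and "B \<equiv> hx1 u * hx1 v + (\<alpha> - \<beta>) * hx0 u * hx0 v"
    and "A' \<equiv> hx1 u * hx0 v - hx0 u * hx1 v"
    and "B' \<equiv> hx1 u * hx1 v - (\<alpha> - \<beta>) * hx0 u * hx0 v"
  shows "fibre_form 2 2 2 (nodal_coeff \<alpha> \<beta>) (zeta_coord \<beta> u) (zeta_coord \<beta> v) =
    [:- (B\<^sup>2 + \<beta> * A\<^sup>2), A\<^sup>2:] * [:- (B'\<^sup>2 + \<beta> * A'\<^sup>2), A'\<^sup>2:]"
proof -
  define X where "X m j = hx1 (zeta_coord \<beta> m) ^ j * hx0 (zeta_coord \<beta> m) ^ (2 - j)" for m and j :: nat
  have zeta: "hx1 (zeta_coord \<beta> m) = (hx1 m)\<^sup>2 + \<beta> * (hx0 m)\<^sup>2"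
    "hx0 (zeta_coord \<beta> m) = (hx0 m)\<^sup>2" for m
    by (cases m; simp)+
  have X: "X m 0 = hx0 m ^ 4" "X m 1 = ((hx1 m)\<^sup>2 + \<beta> * (hx0 m)\<^sup>2) * (hx0 m)\<^sup>2"
    "X m 2 = ((hx1 m)\<^sup>2 + \<beta> * (hx0 m)\<^sup>2)\<^sup>2" for m
    unfolding X_def zeta by simp_all
  have form: "fibre_form 2 2 2 (nodal_coeff \<alpha> \<beta>) (zeta_coord \<beta> u) (zeta_coord \<beta> v) =
    [:(\<Sum>j\<le>2. \<Sum>k\<le>2. nodal_coeff \<alpha> \<beta> 0 j k * X u j * X v k),
      (\<Sum>j\<le>2. \<Sum>k\<le>2. nodal_coeff \<alpha> \<beta> 1 j k * X u j * X v k),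
      (\<Sum>j\<le>2. \<Sum>k\<le>2. nodal_coeff \<alpha> \<beta> 2 j k * X u j * X v k):]"
    unfolding fibre_form_def X_def by (simp add: numeral_2_eq_2 monom_Suc monom_0)
  have c0: "(\<Sum>j\<le>2. \<Sum>k\<le>2. nodal_coeff \<alpha> \<beta> 0 j k * X u j * X v k) =
      (B\<^sup>2 + \<beta> * A\<^sup>2) * (B'\<^sup>2 + \<beta> * A'\<^sup>2)"
    unfolding nodal_coeff_sum X A_def B_def A'_def B'_def by algebra
  have c1: "(\<Sum>j\<le>2. \<Sum>k\<le>2. nodal_coeff \<alpha> \<beta> 1 j k * X u j * X v k) =
      - (B\<^sup>2 + \<beta> * A\<^sup>2) * A'\<^sup>2 - A\<^sup>2 * (B'\<^sup>2 + \<beta> * A'\<^sup>2)"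
    unfolding nodal_coeff_sum X A_def B_def A'_def B'_def by algebra
  have c2: "(\<Sum>j\<le>2. \<Sum>k\<le>2. nodal_coeff \<alpha> \<beta> 2 j k * X u j * X v k) = A\<^sup>2 * A'\<^sup>2"
    unfolding nodal_coeff_sum X A_def B_def A'_def B'_def by algebra
  show ?thesis unfolding form c0 c1 c2 by (simp add: algebra_simps)
qed

lemma op_of_form_nodal_coeff:
  "op_of_form 2 2 2 (nodal_coeff \<alpha> \<beta>) (zeta_coord \<beta> u) (zeta_coord \<beta> v) = nodal_product \<alpha> \<beta> u v"
proof -
  define A B A' B' where AB: "A = hx1 u * hx0 v + hx0 u * hx1 v"
    "B = hx1 u * hx1 v + (\<alpha> - \<beta>) * hx0 u * hx0 v"
    "A' = hx1 u * hx0 v - hx0 u * hx1 v" "B' = hx1 u * hx1 v - (\<alpha> - \<beta>) * hx0 u * hx0 v"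
  have fib: "fibre_form 2 2 2 (nodal_coeff \<alpha> \<beta>) (zeta_coord \<beta> u) (zeta_coord \<beta> v) =
    [:- (B\<^sup>2 + \<beta> * A\<^sup>2), A\<^sup>2:] * [:- (B'\<^sup>2 + \<beta> * A'\<^sup>2), A'\<^sup>2:]"
    unfolding AB by (rule fibre_form_nodal_coeff)
  have prod: "nodal_product \<alpha> \<beta> u v = (if A = 0 \<and> B = 0 \<or> A' = 0 \<and> B' = 0 then None
      else Some {#zeta_coord \<beta> (ratio B A), zeta_coord \<beta> (ratio B' A')#})"
    by (simp add: nodal_product_def AB Let_def)
  have nz: "b\<^sup>2 + \<beta> * a\<^sup>2 \<noteq> 0 \<or> a\<^sup>2 \<noteq> 0 \<longleftrightarrow> \<not> (a = 0 \<and> b = 0)" for a b by auto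
  have zero: "[:- (b\<^sup>2 + \<beta> * a\<^sup>2), a\<^sup>2:] = 0 \<longleftrightarrow> a = 0 \<and> b = 0" for a b by auto
  show ?thesis
  proof (cases "A = 0 \<and> B = 0 \<or> A' = 0 \<and> B' = 0")
    case True
    then show ?thesis
      unfolding op_of_form_def fib prod Let_def mult_eq_0_iff zero by simp
  next
    case False
    then have "zeros_form 2 ([:- (B\<^sup>2 + \<beta> * A\<^sup>2), A\<^sup>2:] * [:- (B'\<^sup>2 + \<beta> * A'\<^sup>2), A'\<^sup>2:]) =
      {#zeta_coord \<beta> (ratio B A), zeta_coord \<beta> (ratio B' A')#}"
      unfolding zeta_coord_ratio by (intro zeros_form_mult_linear) (simp_all only: nz, simp_all)
    with False show ?thesis
      unfolding op_of_form_def fib prod Let_def mult_eq_0_iff zero by simp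
  qed
qed

lemma node_coset_monoid_iff_form:
  "node_coset_monoid \<alpha> \<beta> f \<longleftrightarrow> f = op_of_form 2 2 2 (nodal_coeff \<alpha> \<beta>)"
proof -
  have M: "node_coset_monoid \<alpha> \<beta> (op_of_form 2 2 2 (nodal_coeff \<alpha> \<beta>))"
    by (simp add: node_coset_monoid_iff op_of_form_nodal_coeff)
  show ?thesis
  proof
    assume "node_coset_monoid \<alpha> \<beta> f"
    then show "f = op_of_form 2 2 2 (nodal_coeff \<alpha> \<beta>)"
      using M unfolding node_coset_monoid_def by (rule coset_monoid_unique)
  qed (use M in simp)
qed

lemma nvalued_monoid_node:
  "node_coset_monoid \<alpha> \<beta> f \<Longrightarrow> nvalued_monoid 2 f Infty"
  unfolding node_coset_monoid_def by (rule coset_monoid_imp_nvalued_monoid)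

lemma node_product_sqrt:
  assumes "node_coset_monoid \<alpha> \<beta> f" "r\<^sup>2 = x - \<beta>" "s\<^sup>2 = y - \<beta>"
  shows "f (Aff x) (Aff y) = (if x = \<alpha> \<and> y = \<alpha> then None else
    Some {#zeta_coord \<beta> (ratio (r * s + (\<alpha> - \<beta>)) (r + s)),
           zeta_coord \<beta> (ratio (r * s - (\<alpha> - \<beta>)) (r - s))#})"
proof -
  have xy: "Aff x = zeta_coord \<beta> (Aff r)" "Aff y = zeta_coord \<beta> (Aff s)"
    using assms(2,3) by simp_all
  have "(r + s = 0 \<and> r * s + (\<alpha> - \<beta>) = 0 \<or> r - s = 0 \<and> r * s - (\<alpha> - \<beta>) = 0) \<longleftrightarrow>
    r\<^sup>2 = \<alpha> - \<beta> \<and> s\<^sup>2 = \<alpha> - \<beta>"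
  proof
    assume "r\<^sup>2 = \<alpha> - \<beta> \<and> s\<^sup>2 = \<alpha> - \<beta>"
    moreover from this have "r = s \<or> r = - s" by (simp flip: power2_eq_iff)
    ultimately show "r + s = 0 \<and> r * s + (\<alpha> - \<beta>) = 0 \<or> r - s = 0 \<and> r * s - (\<alpha> - \<beta>) = 0"
      by (auto simp: power2_eq_square)
  qed (auto simp: power2_eq_square add_eq_0_iff)
  also have "\<dots> \<longleftrightarrow> x = \<alpha> \<and> y = \<alpha>" unfolding assms(2,3) by simp
  finally have dom: "(r + s = 0 \<and> r * s + (\<alpha> - \<beta>) = 0 \<or> r - s = 0 \<and> r * s - (\<alpha> - \<beta>) = 0) \<longleftrightarrow>
    x = \<alpha> \<and> y = \<alpha>" .
  have "nodal_product \<alpha> \<beta> (Aff r) (Aff s) =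
    (if r + s = 0 \<and> r * s + (\<alpha> - \<beta>) = 0 \<or> r - s = 0 \<and> r * s - (\<alpha> - \<beta>) = 0 then None else
      Some {#zeta_coord \<beta> (ratio (r * s + (\<alpha> - \<beta>)) (r + s)),
             zeta_coord \<beta> (ratio (r * s - (\<alpha> - \<beta>)) (r - s))#})"
    by (simp add: nodal_product_def Let_def)
  moreover have "f (zeta_coord \<beta> (Aff r)) (zeta_coord \<beta> (Aff s)) = nodal_product \<alpha> \<beta> (Aff r) (Aff s)"
    using assms(1) unfolding node_coset_monoid_iff by blast
  ultimately show ?thesis unfolding xy dom by simp
qed

text \<open>A slope \<open>s\<close> with \<open>s\<^sup>2 = \<alpha> - \<beta>\<close> is the class of a zero divisor \<open>e\<close>, and \<open>x e\<close> is a scalar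
  multiple of \<open>e\<close> for every \<open>x\<close>: concretely, \<open>r s + (\<alpha> - \<beta>) = s (r + s)\<close>.\<close>

lemma node_product_absorbing:
  assumes "node_coset_monoid \<alpha> \<beta> f" "x \<noteq> Aff \<alpha>"
  shows "f x (Aff \<alpha>) = Some {#Aff \<alpha>, Aff \<alpha>#}" "f (Aff \<alpha>) x = Some {#Aff \<alpha>, Aff \<alpha>#}"
proof -
  define s where "s = csqrt (\<alpha> - \<beta>)"
  have s: "s\<^sup>2 = \<alpha> - \<beta>" by (simp add: s_def)
  have "f x (Aff \<alpha>) = Some {#Aff \<alpha>, Aff \<alpha>#} \<and> f (Aff \<alpha>) x = Some {#Aff \<alpha>, Aff \<alpha>#}"
  proof (cases x)
    case Infty
    then show ?thesis using nvalued_monoid_node[OF assms(1)] unfolding Infty nvalued_monoid_def by (simp add: numeral_2_eq_2)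
  next
    case (Aff z)
    define r where "r = csqrt (z - \<beta>)"
    have r: "r\<^sup>2 = z - \<beta>" by (simp add: r_def)
    have "z \<noteq> \<alpha>" using assms(2) Aff by simp
    then have ne: "r\<^sup>2 \<noteq> s\<^sup>2" using r s by simp
    then have nz: "r + s \<noteq> 0" "r - s \<noteq> 0" "s + r \<noteq> 0" "s - r \<noteq> 0"
      by (auto simp: power2_eq_iff add_eq_0_iff)
    have eqs: "r * s + (\<alpha> - \<beta>) = s * (r + s)" "r * s - (\<alpha> - \<beta>) = s * (r - s)"
      "s * r + (\<alpha> - \<beta>) = s * (s + r)" "s * r - (\<alpha> - \<beta>) = - s * (s - r)"
      using s by (simp_all add: algebra_simps power2_eq_square)
    show ?thesis
      using \<open>z \<noteq> \<alpha>\<close> nz s unfolding Aff node_product_sqrt[OF assms(1) r s] 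
        node_product_sqrt[OF assms(1) s r] eqs by (simp add: ratio_def)
  qed
  then show "f x (Aff \<alpha>) = Some {#Aff \<alpha>, Aff \<alpha>#}" "f (Aff \<alpha>) x = Some {#Aff \<alpha>, Aff \<alpha>#}" by auto
qed

text \<open>A sum of slopes is \<open>\<infinity>\<close> only for opposite slopes, which lie in one orbit.  Thus \<open>x\<close> is the
  only candidate for its inverse, and the single obstruction is that \<open>x \<ast> x\<close> be undefined.\<close>

lemma nvalued_inverse_node_iff:
  assumes M: "node_coset_monoid \<alpha> \<beta> f"
  shows "nvalued_inverse f Infty (Aff x) y \<longleftrightarrow> x \<noteq> \<alpha> \<and> y = Aff x"
proof (cases y)
  case Infty
  then show ?thesis
    using nvalued_monoid_node[OF M] unfolding Infty nvalued_inverse_def nvalued_monoid_def by (simp add: numeral_2_eq_2)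
next
  case (Aff z)
  define r s where "r = csqrt (x - \<beta>)" "s = csqrt (z - \<beta>)"
  then have rs: "r\<^sup>2 = x - \<beta>" "s\<^sup>2 = z - \<beta>" by simp_all
  have inf: "zeta_coord \<beta> (ratio b a) = Infty \<longleftrightarrow> a = 0" for a b
    by (simp add: ratio_def)
  have "r + s = 0 \<or> r - s = 0 \<longleftrightarrow> r\<^sup>2 = s\<^sup>2"
    by (auto simp: power2_eq_iff eq_neg_iff_add_eq_0)
  then have "r + s = 0 \<or> r - s = 0 \<longleftrightarrow> x = z" using rs by simp
  moreover have "s + r = 0 \<longleftrightarrow> r + s = 0" "s - r = 0 \<longleftrightarrow> r - s = 0"
    by (auto simp: add.commute)
  ultimately show ?thesis
    unfolding Aff nvalued_inverse_def node_product_sqrt[OF M rs] node_product_sqrt[OF M rs(2,1)]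
    by (auto simp: inf eq_commute[of Infty])
qed

lemma node_product_zero_zero:
  assumes M: "node_coset_monoid \<alpha> \<beta> f" and "\<alpha> \<noteq> 0"
  shows "f (Aff 0) (Aff 0) =
    Some {#if \<beta> = 0 then Infty else Aff (\<alpha> * (1 - \<alpha> / (4 * \<beta>))), Infty#}"
proof -
  define r where "r = csqrt (- \<beta>)"
  have r: "r\<^sup>2 = 0 - \<beta>" by (simp add: r_def)
  then have rr: "r * r = - \<beta>" by (simp add: power2_eq_square)
  have "(r * r + (\<alpha> - \<beta>))\<^sup>2 / (r + r)\<^sup>2 + \<beta> = \<alpha> * (1 - \<alpha> / (4 * \<beta>))" if "\<beta> \<noteq> 0"
  proof -
    have rr4: "(r + r)\<^sup>2 = - 4 * \<beta>" using rr by (simp add: power2_eq_square algebra_simps)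
    show ?thesis unfolding rr rr4 using that by (simp add: field_simps power2_eq_square)
  qed
  moreover have "r = 0 \<longleftrightarrow> \<beta> = 0" using r by auto
  ultimately show ?thesis
    using \<open>\<alpha> \<noteq> 0\<close> by (auto simp: node_product_sqrt[OF M r r] ratio_def power_divide simp flip: mult_2)
qed


section \<open>Rationality and isomorphisms\<close>

lemma algebraic_node_coset_monoid:
  assumes M: "node_coset_monoid \<alpha> \<beta> f"
  shows "algebraic_nvalued_monoid 2 f Infty"
proof -
  have nv: "nvalued_monoid 2 f Infty" using M by (rule nvalued_monoid_node)
  have "f = op_of_form 2 2 2 (nodal_coeff \<alpha> \<beta>)" using M node_coset_monoid_iff_form by blast
  moreover have "f Infty Infty \<noteq> None" using nv by (simp add: nvalued_monoid_def)
  ultimately have "rational_op 2 f" unfolding rational_op_def by metis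
  with nv show ?thesis by (simp add: algebraic_nvalued_monoid_def)
qed

definition affine_map :: "complex \<Rightarrow> complex \<Rightarrow> cp1 \<Rightarrow> cp1" where
  "affine_map a b x = ratio (a * hx1 x + b * hx0 x) (hx0 x)"

lemma regular_affine_map:
  assumes "a \<noteq> 0" shows "regular_cp1 (affine_map a b)"
proof -
  have "eval_form 1 [:b, a:] x = a * hx1 x + b * hx0 x" "eval_form 1 [:1:] x = hx0 x" for x
    by (simp_all add: eval_form_def)
  moreover have "a * hx1 x + b * hx0 x \<noteq> 0 \<or> hx0 x \<noteq> 0" for x using assms by (cases x) auto
  ultimately show ?thesis unfolding regular_cp1_def affine_map_def by metis
qed

text \<open>The inverse is again an affine map, so both directions are regular.\<close>

lemma cp1_isomorphism_affine_map:
  assumes "a \<noteq> 0" shows "cp1_isomorphism (affine_map a b)"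
proof -
  have 1: "affine_map (1 / a) (- b / a) \<circ> affine_map a b = id"
  proof
    fix x show "(affine_map (1 / a) (- b / a) \<circ> affine_map a b) x = id x"
      using assms by (cases x) (auto simp: affine_map_def ratio_def field_simps)
  qed
  have 2: "affine_map a b \<circ> affine_map (1 / a) (- b / a) = id"
  proof
    fix x show "(affine_map a b \<circ> affine_map (1 / a) (- b / a)) x = id x"
      using assms by (cases x) (auto simp: affine_map_def ratio_def field_simps)
  qed
  have "bij (affine_map a b)" "inv (affine_map a b) = affine_map (1 / a) (- b / a)"
    using o_bij[OF 1 2] inv_unique_comp[OF 2 1] .
  then show ?thesis using assms by (simp add: cp1_isomorphism_def regular_affine_map)
qed

lemma node_coset_monoids_isomorphic:
  assumes "\<alpha> \<noteq> \<beta>" "\<alpha>' \<noteq> \<beta>'" "node_coset_monoid \<alpha> \<beta> f" "node_coset_monoid \<alpha>' \<beta>' g"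
  shows "nvalued_isomorphic f g"
proof -
  define k where "k = csqrt ((\<alpha>' - \<beta>') / (\<alpha> - \<beta>))"
  have k: "k \<noteq> 0" "\<alpha>' - \<beta>' = k\<^sup>2 * (\<alpha> - \<beta>)" using assms(1,2) by (simp_all add: k_def)
  have comm: "scale_slope k (h u) = h (scale_slope k u)" if "h \<in> {id, nodal_sigma}" for h u
    using that k(1) by (auto simp: nodal_sigma_eq_scale scale_slope_scale_slope)
  have proj: "affine_map (k\<^sup>2) (\<beta>' - k\<^sup>2 * \<beta>) (zeta_coord \<beta> u) = zeta_coord \<beta>' (scale_slope k u)" for u
    by (cases u) (auto simp: affine_map_def scale_slope_def ratio_def algebra_simps)
  have "g (affine_map (k\<^sup>2) (\<beta>' - k\<^sup>2 * \<beta>) x) (affine_map (k\<^sup>2) (\<beta>' - k\<^sup>2 * \<beta>) y) =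
    map_option (image_mset (affine_map (k\<^sup>2) (\<beta>' - k\<^sup>2 * \<beta>))) (f x y)" for x y
    by (rule coset_monoid_hom[OF assms(3,4)[unfolded node_coset_monoid_def]
          nodal_add_scale_slope[OF k] comm proj])
  moreover have "cp1_isomorphism (affine_map (k\<^sup>2) (\<beta>' - k\<^sup>2 * \<beta>))"
    using k(1) by (intro cp1_isomorphism_affine_map) simp
  ultimately show ?thesis unfolding nvalued_isomorphic_def by blast
qed

theorem theorem6:
  fixes \<alpha> \<beta> :: complex
  assumes "\<alpha> \<noteq> \<beta>"
  shows "(\<exists>!f. node_coset_monoid \<alpha> \<beta> f) \<and>
    (\<forall>f. node_coset_monoid \<alpha> \<beta> f \<longrightarrow>
      algebraic_nvalued_monoid 2 f Infty \<and>
      (\<forall>\<alpha>' \<beta>' g. \<alpha>' \<noteq> \<beta>' \<longrightarrow> node_coset_monoid \<alpha>' \<beta>' g \<longrightarrow> nvalued_isomorphic f g) \<and>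
      (\<forall>\<zeta>1 \<zeta>2 r1 r2. r1\<^sup>2 = \<zeta>1 - \<beta> \<longrightarrow> r2\<^sup>2 = \<zeta>2 - \<beta> \<longrightarrow> (\<zeta>1, \<zeta>2) \<noteq> (\<alpha>, \<alpha>) \<longrightarrow>
         f (Aff \<zeta>1) (Aff \<zeta>2) =
           Some {#zeta_coord \<beta> (ratio (r1 * r2 + (\<alpha> - \<beta>)) (r1 + r2)),
                  zeta_coord \<beta> (ratio (r1 * r2 - (\<alpha> - \<beta>)) (r1 - r2))#}) \<and>
      (\<exists>c. (\<forall>z \<zeta>1 \<zeta>2. z \<noteq> 0 \<longrightarrow> \<zeta>1 \<noteq> 0 \<longrightarrow> \<zeta>2 \<noteq> 0 \<longrightarrow>
              (\<Sum>i\<le>2. \<Sum>j\<le>2. \<Sum>k\<le>2. c i j k * z ^ i * \<zeta>1 ^ j * \<zeta>2 ^ k) =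
              (\<zeta>1 * \<zeta>2 * z)\<^sup>2 * B_poly \<alpha> \<beta> (1 / z) (1 / \<zeta>1) (1 / \<zeta>2)) \<and>
           f = op_of_form 2 2 2 c) \<and>
      (\<forall>\<zeta>. \<zeta> \<noteq> Aff \<alpha> \<longrightarrow>
         f \<zeta> (Aff \<alpha>) = Some {#Aff \<alpha>, Aff \<alpha>#} \<and> f (Aff \<alpha>) \<zeta> = Some {#Aff \<alpha>, Aff \<alpha>#}) \<and>
      f (Aff \<alpha>) (Aff \<alpha>) = None \<and>
      ((\<exists>x'. nvalued_inverse f Infty (Aff 0) x') \<longleftrightarrow> \<alpha> \<noteq> 0) \<and>
      (\<alpha> \<noteq> 0 \<longrightarrow>
         (\<forall>x'. nvalued_inverse f Infty (Aff 0) x' \<longleftrightarrow> x' = Aff 0) \<and>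
         f (Aff 0) (Aff 0) =
           Some {#if \<beta> = 0 then Infty else Aff (\<alpha> * (1 - \<alpha> / (4 * \<beta>))), Infty#}))"
proof -
  have ex1: "\<exists>!f. node_coset_monoid \<alpha> \<beta> f" by (simp add: node_coset_monoid_iff_form)
  have undef: "f (Aff \<alpha>) (Aff \<alpha>) = None" if "node_coset_monoid \<alpha> \<beta> f" for f
    using node_product_sqrt[OF that power2_csqrt power2_csqrt, of \<alpha> \<alpha>] by simp
  show ?thesis
  proof (intro conjI ex1 allI impI)
    fix f assume M: "node_coset_monoid \<alpha> \<beta> f"
    show "algebraic_nvalued_monoid 2 f Infty" using M by (rule algebraic_node_coset_monoid)
    show "nvalued_isomorphic f g" if "\<alpha>' \<noteq> \<beta>'" "node_coset_monoid \<alpha>' \<beta>' g" for \<alpha>' \<beta>' g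
      using node_coset_monoids_isomorphic[OF assms that(1) M that(2)] .
    show "f (Aff \<zeta>1) (Aff \<zeta>2) =
           Some {#zeta_coord \<beta> (ratio (r1 * r2 + (\<alpha> - \<beta>)) (r1 + r2)),
                  zeta_coord \<beta> (ratio (r1 * r2 - (\<alpha> - \<beta>)) (r1 - r2))#}"
      if "r1\<^sup>2 = \<zeta>1 - \<beta>" "r2\<^sup>2 = \<zeta>2 - \<beta>" "(\<zeta>1, \<zeta>2) \<noteq> (\<alpha>, \<alpha>)" for \<zeta>1 \<zeta>2 r1 r2
      using node_product_sqrt[OF M that(1,2)] that(3) by auto
    show "\<exists>c. (\<forall>z \<zeta>1 \<zeta>2. z \<noteq> 0 \<longrightarrow> \<zeta>1 \<noteq> 0 \<longrightarrow> \<zeta>2 \<noteq> 0 \<longrightarrow>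
              (\<Sum>i\<le>2. \<Sum>j\<le>2. \<Sum>k\<le>2. c i j k * z ^ i * \<zeta>1 ^ j * \<zeta>2 ^ k) =
              (\<zeta>1 * \<zeta>2 * z)\<^sup>2 * B_poly \<alpha> \<beta> (1 / z) (1 / \<zeta>1) (1 / \<zeta>2)) \<and>
           f = op_of_form 2 2 2 c"
      using M nodal_coeff_B_poly unfolding node_coset_monoid_iff_form by blast
    show "f \<zeta> (Aff \<alpha>) = Some {#Aff \<alpha>, Aff \<alpha>#}" "f (Aff \<alpha>) \<zeta> = Some {#Aff \<alpha>, Aff \<alpha>#}"
      if "\<zeta> \<noteq> Aff \<alpha>" for \<zeta>
      using node_product_absorbing[OF M that] by auto
    show "f (Aff \<alpha>) (Aff \<alpha>) = None" using M by (rule undef)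
    show "(\<exists>x'. nvalued_inverse f Infty (Aff 0) x') \<longleftrightarrow> \<alpha> \<noteq> 0"
      by (auto simp: nvalued_inverse_node_iff[OF M])
    show "nvalued_inverse f Infty (Aff 0) x' \<longleftrightarrow> x' = Aff 0" if "\<alpha> \<noteq> 0" for x'
      using that by (auto simp: nvalued_inverse_node_iff[OF M])
    show "f (Aff 0) (Aff 0) =
      Some {#if \<beta> = 0 then Infty else Aff (\<alpha> * (1 - \<alpha> / (4 * \<beta>))), Infty#}" if "\<alpha> \<noteq> 0"
      using node_product_zero_zero[OF M that] .
  qed
qed

end
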